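(* The set $\Lambda$ is closed in $X\times\mathbb{R}$, and in particular it is compact.
   Context: $X=\mathbb{R}/\mathbb{Z}$ with its quotient metric, $T:X\to X$ is the doubling map $T(x)=2x$, $0<\lambda<1$ is fixed, $\mathcal{C}=\{0,\dots,m-1\}$ with $m\ge 2$, and $A_c:X\to\mathbb{R}$ ($c\in\mathcal{C}$) are Lipschitz functions. $G_c(x,y)=(T(x),A_c(x)+\lambda y)$ on $X\times\mathbb{R}$. $\Lambda$ is the set of $(x,y)\in X\times\mathbb{R}$ for which there exist $M>0$, $\bar c=(c_0,c_1,\dots)\in\mathcal{C}^{\mathbb{N}}$ and a sequence $(x_n,y_n)_{n\ge0}$ in $X\times\mathbb{R}$ with $(x_0,y_0)=(x,y)$, $G_{c_n}(x_{n+1},y_{n+1})=(x_n,y_n)$ and $|y_n|\le M$ for all $n\geq 0$. Equivalently, $\Lambda=\{(x,S_x(\bar c,\bar a)): x\in X,\ \bar c\in\mathcal{C}^{\mathbb{N}},\ \bar a\in\{0,1\}^{\mathbb{N}}\}$, where $S_x(\bar c,\bar a)=\sum_{i\ge0}\lambda^iA_{c_i}(\tau_{a_i}\circ\cdots\circ\tau_{a_0}(x))$ and $\tau_i(x)=\frac12x+\frac i2$ (with $x\in[0,1)$ as representative), $i=0,1$, are the inverse branches of $T$. *)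

theory Defs
  imports "HOL-Analysis.Analysis"
begin

quotient_type circle = real / "\<lambda>a b :: real. a - b \<in> \<int>"
  morphisms rep_circle to_circle
proof (rule equivpI)
  show "reflp (\<lambda>a b :: real. a - b \<in> \<int>)"
    by (simp add: reflp_def)
  show "symp (\<lambda>a b :: real. a - b \<in> \<int>)"
    unfolding symp_def using Ints_minus by fastforce
  show "transp (\<lambda>a b :: real. a - b \<in> \<int>)"
    unfolding transp_def using Ints_add by fastforce
qed

lemma to_circle_eq_iff: "to_circle a = to_circle b \<longleftrightarrow> a - b \<in> \<int>"
  by (rule circle.abs_eq_iff)

lemma to_circle_surj: "\<exists>a. to_circle a = x"
  by (metis Quotient3_abs_rep Quotient3_circle)

instantiation circle :: metric_space
begin

definition dist_circle :: "circle \<Rightarrow> circle \<Rightarrow> real" where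
  "dist_circle x y = Inf {\<bar>a - b\<bar> | a b. to_circle a = x \<and> to_circle b = y}"

definition uniformity_circle :: "(circle \<times> circle) filter" where
  "uniformity_circle = (INF e\<in>{0 <..}. principal {(x, y). dist x y < e})"

definition open_circle :: "circle set \<Rightarrow> bool" where
  "open_circle U \<longleftrightarrow> (\<forall>x\<in>U. eventually (\<lambda>(x', y). x' = x \<longrightarrow> y \<in> U) uniformity)"

lemma dist_circle_le:
  assumes "to_circle a = x" "to_circle b = y"
  shows "dist x y \<le> \<bar>a - b\<bar>"
  unfolding dist_circle_def
proof (rule cInf_lower)
  show "bdd_below {\<bar>a - b\<bar> | a b. to_circle a = x \<and> to_circle b = y}"
    by (rule bdd_belowI[of _ 0]) auto
qed (use assms in blast)

lemma dist_circle_attained: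
  fixes x y :: circle
  obtains a b where "to_circle a = x" "to_circle b = y" "dist x y = \<bar>a - b\<bar>"
proof -
  obtain a0 b0 where ab0: "to_circle a0 = x" "to_circle b0 = y"
    using to_circle_surj by metis
  define t where "t = a0 - b0"
  define k where "k = round t"
  define b where "b = b0 + of_int k"
  have b: "to_circle b = y"
    unfolding b_def using ab0(2) by (metis Ints_of_int add_diff_cancel_left' to_circle_eq_iff)
  have "dist x y \<ge> \<bar>a0 - b\<bar>"
    unfolding dist_circle_def
  proof (rule cInf_greatest)
    show "{\<bar>a - b\<bar> | a b. to_circle a = x \<and> to_circle b = y} \<noteq> {}"
      using ab0 by blast
  next
    fix r assume "r \<in> {\<bar>a - b\<bar> | a b. to_circle a = x \<and> to_circle b = y}"
    then obtain c d where cd: "to_circle c = x" "to_circle d = y" "r = \<bar>c - d\<bar>"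
      by blast
    have "c - a0 \<in> \<int>" "d - b0 \<in> \<int>"
      using cd ab0 to_circle_eq_iff by metis+
    then obtain i j where "c - a0 = of_int i" "d - b0 = of_int j"
      by (metis Ints_cases)
    then have "c - d = t - of_int (j - i)"
      unfolding t_def by simp
    moreover have "\<bar>a0 - b\<bar> = \<bar>t - of_int (round t)\<bar>"
      unfolding b_def k_def t_def by (simp add: algebra_simps)
    ultimately show "\<bar>a0 - b\<bar> \<le> r"
      using round_diff_minimal[of t "j - i"] cd(3) by simp
  qed
  with dist_circle_le[OF ab0(1) b] have "dist x y = \<bar>a0 - b\<bar>"
    by simp
  then show thesis
    using that ab0(1) b by blast
qed

instance
proof
  show "uniformity = (INF e\<in>{0 <..}. principal {(x, y :: circle). dist x y < e})"
    by (rule uniformity_circle_def)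
  show "open U = (\<forall>x\<in>U. \<forall>\<^sub>F (x', y) in uniformity. x' = x \<longrightarrow> y \<in> U)" for U :: "circle set"
    by (rule open_circle_def)
  show "dist x y = 0 \<longleftrightarrow> x = y" for x y :: circle
  proof
    assume "dist x y = 0"
    then show "x = y"
      by (metis abs_eq_0 dist_circle_attained eq_iff_diff_eq_0)
  next
    assume "x = y"
    moreover obtain a where "to_circle a = x"
      using to_circle_surj by blast
    ultimately have "dist x y \<le> 0"
      using dist_circle_le[of a x a y] by simp
    moreover have "dist x y \<ge> 0"
      by (metis abs_ge_zero dist_circle_attained)
    ultimately show "dist x y = 0"
      by simp
  qed
  show "dist x y \<le> dist x z + dist y z" for x y z :: circle
  proof -
    obtain a c where ac: "to_circle a = x" "to_circle c = z" "dist x z = \<bar>a - c\<bar>"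
      by (rule dist_circle_attained)
    obtain b d where bd: "to_circle b = y" "to_circle d = z" "dist y z = \<bar>b - d\<bar>"
      by (rule dist_circle_attained)
    have "c - d \<in> \<int>"
      using ac bd to_circle_eq_iff by metis
    then have "to_circle (b + (c - d)) = y"
      using bd(1) by (metis add_diff_cancel_left' to_circle_eq_iff)
    from dist_circle_le[OF ac(1) this]
    show ?thesis
      using ac(3) bd(3) by linarith
  qed
qed

end

lift_definition doubling :: "circle \<Rightarrow> circle" is "\<lambda>a. 2 * a"
proof -
  fix a b :: real
  assume "a - b \<in> \<int>"
  then have "2 * (a - b) \<in> \<int>"
    by (intro Ints_mult) auto
  then show "2 * a - 2 * b \<in> \<int>"
    by (simp add: algebra_simps)
qed

definition skew_map ::
    "real \<Rightarrow> (nat \<Rightarrow> circle \<Rightarrow> real) \<Rightarrow> nat \<Rightarrow> circle \<times> real \<Rightarrow> circle \<times> real" where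
  "skew_map lam A c = (\<lambda>(x, y). (doubling x, A c x + lam * y))"

text \<open>The bound \<open>M\<close> may depend on the point.\<close>

definition Lambda_set :: "real \<Rightarrow> nat \<Rightarrow> (nat \<Rightarrow> circle \<Rightarrow> real) \<Rightarrow> (circle \<times> real) set" where
  "Lambda_set lam m A =
    {p. \<exists>M > 0. \<exists>(c :: nat \<Rightarrow> nat) (q :: nat \<Rightarrow> circle \<times> real).
       (\<forall>n. c n \<in> {..<m}) \<and> q 0 = p \<and>
       (\<forall>n. skew_map lam A (c n) (q (Suc n)) = q n) \<and>
       (\<forall>n. \<bar>snd (q n)\<bar> \<le> M)}"

end

theory Submission
  imports Defs
begin

text \<open>
  Write \<open>F S = (\<Union>c<m. G\<^sub>c ` S)\<close> for the Hutchinson-type operator of the maps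
  \<open>G\<^sub>c = skew_map lam A c\<close>. The set \<open>\<Lambda> = Lambda_set lam m A\<close> satisfies \<open>\<Lambda> \<subseteq> F \<Lambda>\<close>
  (\<open>Lambda_set_subset_images\<close>), and it contains every set \<open>S \<subseteq> F S\<close> whose second coordinates
  are bounded (\<open>subset_Lambda_setI\<close>), since in such an \<open>S\<close> preimages can be chosen forever.

  The fibre maps contract by \<open>lam\<close>, so a bounded backward orbit obeys a bound \<open>R\<close> that does not
  depend on the orbit (\<open>backward_contraction_bound\<close>). Hence \<open>\<Lambda>\<close> lies in the compact set
  \<open>X \<times> [-R, R]\<close>, and its closure \<open>S\<close> is compact. Now \<open>F S\<close> is a finite union of continuous
  images of a compact set, so it is closed; as it contains \<open>F \<Lambda> \<supseteq> \<Lambda>\<close>, it contains \<open>S\<close>. So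
  \<open>S \<subseteq> F S\<close>, and maximality gives \<open>S \<subseteq> \<Lambda>\<close>. This replaces the extraction of a limit
  of backward orbits by a diagonal argument.
\<close>

lemma lipschitz_on_to_circle: "1-lipschitz_on UNIV to_circle"
  by (rule lipschitz_onI) (simp_all add: dist_circle_le dist_real_def)

text \<open>Fractional parts give representatives, so the circle is a continuous image of \<open>{0..1}\<close>.\<close>

lemma compact_UNIV_circle: "compact (UNIV :: circle set)"
proof -
  have "x \<in> to_circle ` {0..1}" for x
  proof -
    obtain a where a: "to_circle a = x"
      using to_circle_surj by blast
    have "a - frac a \<in> \<int>"
      by (simp add: frac_def)
    then have "to_circle (frac a) = x"
      using a to_circle_eq_iff by metis
    moreover have "frac a \<in> {0..1}"
      using frac_lt_1[of a] by simp
    ultimately show ?thesis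
      by blast
  qed
  then have "UNIV = to_circle ` {0..1}"
    by blast
  moreover have "continuous_on {0..1} to_circle"
    using lipschitz_on_continuous_on[OF lipschitz_on_to_circle] continuous_on_subset by blast
  ultimately show ?thesis
    using compact_continuous_image[of "{0..1}" to_circle] by simp
qed

text \<open>The distance is attained by two representatives, and doubling these doubles their distance.\<close>

lemma lipschitz_on_doubling: "2-lipschitz_on UNIV doubling"
proof (rule lipschitz_onI)
  fix x y :: circle
  obtain a b where ab: "to_circle a = x" "to_circle b = y" "dist x y = \<bar>a - b\<bar>"
    by (rule dist_circle_attained)
  have "to_circle (2 * a) = doubling x" "to_circle (2 * b) = doubling y"
    using ab(1,2) doubling.abs_eq by metis+
  from dist_circle_le[OF this] show "dist (doubling x) (doubling y) \<le> 2 * dist x y"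
    using ab(3) by linarith
qed simp

lemma continuous_on_skew_map:
  assumes "continuous_on UNIV (A c)"
  shows "continuous_on S (skew_map lam A c)"
proof -
  have "continuous_on S (\<lambda>p. A c (fst p))" "continuous_on S (\<lambda>p. doubling (fst p))"
    using assms lipschitz_on_continuous_on[OF lipschitz_on_doubling]
    by (auto intro!: continuous_on_compose2[of UNIV _ S fst] continuous_intros)
  then show ?thesis
    unfolding skew_map_def case_prod_beta by (intro continuous_intros)
qed

text \<open>
  Iterating the inequality \<open>k\<close> times leaves of the bound \<open>M\<close> only \<open>lam ^ k * M\<close>, on top of
  the geometric series of the constant \<open>K\<close>, whose sum is \<open>K / (1 - lam)\<close>.
\<close>

lemma backward_contraction_bound:
  fixes y :: "nat \<Rightarrow> real"
  assumes lam: "0 \<le> lam" "lam < 1"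
    and step: "\<And>n. \<bar>y n\<bar> \<le> K + lam * \<bar>y (Suc n)\<bar>"
    and bdd: "\<And>n. \<bar>y n\<bar> \<le> M"
  shows "\<bar>y n\<bar> \<le> K / (1 - lam)"
proof -
  define R where "R = K / (1 - lam)"
  have R: "K + lam * R = R"
    using lam by (simp add: R_def field_simps)
  \<comment> \<open>That \<open>R \<ge> 0\<close> is only known from the conclusion; adding \<open>\<bar>R\<bar>\<close> gives the case \<open>k = 0\<close> without it.\<close>
  have iterate: "\<bar>y n\<bar> \<le> R + lam ^ k * (M + \<bar>R\<bar>)" for k n
  proof (induction k arbitrary: n)
    case 0
    show ?case
      using bdd[of n] by simp
  next
    case (Suc k)
    have "\<bar>y n\<bar> \<le> K + lam * (R + lam ^ k * (M + \<bar>R\<bar>))"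
      using step[of n] mult_left_mono[OF Suc.IH[of "Suc n"] lam(1)] by linarith
    also have "\<dots> = R + lam ^ Suc k * (M + \<bar>R\<bar>)"
      using R by (simp add: algebra_simps)
    finally show ?case .
  qed
  have "(\<lambda>k. R + lam ^ k * (M + \<bar>R\<bar>)) \<longlonglongrightarrow> R + 0 * (M + \<bar>R\<bar>)"
    using lam by (intro tendsto_intros LIMSEQ_realpow_zero)
  then have "\<bar>y n\<bar> \<le> R + 0 * (M + \<bar>R\<bar>)"
    using iterate[of n] by (intro LIMSEQ_le_const) auto
  then show ?thesis
    by (simp add: R_def)
qed

text \<open>Dropping the first term of a backward orbit leaves a backward orbit of the next point.\<close>

lemma Lambda_set_subset_images:
  "Lambda_set lam m A \<subseteq> (\<Union>c<m. skew_map lam A c ` Lambda_set lam m A)"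
proof
  fix p assume "p \<in> Lambda_set lam m A"
  then obtain M c q where M: "M > 0" and c: "\<And>n. c n \<in> {..<m}" and q0: "q 0 = p"
    and step: "\<And>n. skew_map lam A (c n) (q (Suc n)) = q n"
    and bdd: "\<And>n. \<bar>snd (q n)\<bar> \<le> M"
    unfolding Lambda_set_def by blast
  have "q 1 \<in> Lambda_set lam m A"
    unfolding Lambda_set_def mem_Collect_eq
    using M c step bdd
    by (intro exI[of _ M] conjI exI[of _ "\<lambda>n. c (Suc n)"] exI[of _ "\<lambda>n. q (Suc n)"]) auto
  moreover have "p = skew_map lam A (c 0) (q 1)"
    using step[of 0] q0 by simp
  ultimately show "p \<in> (\<Union>c<m. skew_map lam A c ` Lambda_set lam m A)"
    using c by blast
qed

text \<open>
  Every point of \<open>S\<close> has a preimage in \<open>S\<close> under one of the maps; iterating a choice function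
  for these preimages gives a backward orbit that stays in \<open>S\<close>, hence is bounded.
\<close>

lemma subset_Lambda_setI:
  assumes sub: "S \<subseteq> (\<Union>c<m. skew_map lam A c ` S)"
    and bdd: "\<And>p. p \<in> S \<Longrightarrow> \<bar>snd p\<bar> \<le> R"
  shows "S \<subseteq> Lambda_set lam m A"
proof
  fix p assume p: "p \<in> S"
  have "\<forall>r\<in>S. \<exists>c s. c < m \<and> s \<in> S \<and> skew_map lam A c s = r"
    using sub by blast
  then obtain f g where fg: "\<And>r. r \<in> S \<Longrightarrow> f r < m \<and> g r \<in> S \<and> skew_map lam A (f r) (g r) = r"
    by metis
  define q where "q n = (g ^^ n) p" for n
  have q: "q n \<in> S" for n
    by (induction n) (use p fg in \<open>auto simp: q_def\<close>)
  have step: "skew_map lam A (f (q n)) (q (Suc n)) = q n" for n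
    using fg[OF q[of n]] by (simp add: q_def)
  \<comment> \<open>An orbit bound has to be positive, and \<open>R\<close> may be zero.\<close>
  have "\<bar>snd (q n)\<bar> \<le> max R 1" for n
    using bdd[OF q[of n]] by simp
  then show "p \<in> Lambda_set lam m A"
    unfolding Lambda_set_def mem_Collect_eq
    using fg q step
    by (intro exI[of _ "max R 1"] conjI exI[of _ "\<lambda>n. f (q n)"] exI[of _ q])
       (auto simp: q_def)
qed

text \<open>
  The bound allowed in the definition of \<open>Lambda_set\<close> depends on the point; the contraction makes
  it uniform, so the whole set is bounded.
\<close>

lemma Lambda_set_snd_bound:
  assumes lam: "0 \<le> lam" "lam < 1"
    and K: "\<And>c x. c < m \<Longrightarrow> \<bar>A c x\<bar> \<le> K"
    and p: "p \<in> Lambda_set lam m A"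
  shows "\<bar>snd p\<bar> \<le> K / (1 - lam)"
proof -
  obtain M c q where c: "\<And>n. c n < m" and q0: "q 0 = p"
    and step: "\<And>n. skew_map lam A (c n) (q (Suc n)) = q n"
    and bdd: "\<And>n. \<bar>snd (q n)\<bar> \<le> M"
    using p unfolding Lambda_set_def by blast
  have "\<bar>snd (q n)\<bar> \<le> K + lam * \<bar>snd (q (Suc n))\<bar>" for n
  proof -
    have "snd (q n) = A (c n) (fst (q (Suc n))) + lam * snd (q (Suc n))"
      by (subst step[of n, symmetric]) (simp add: skew_map_def case_prod_beta)
    also have "\<bar>\<dots>\<bar> \<le> \<bar>A (c n) (fst (q (Suc n)))\<bar> + lam * \<bar>snd (q (Suc n))\<bar>"
      using lam abs_triangle_ineq[of _ "lam * snd (q (Suc n))"] by (simp add: abs_mult)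
    finally show ?thesis
      using K[OF c[of n], of "fst (q (Suc n))"] by linarith
  qed
  from backward_contraction_bound[of lam "\<lambda>n. snd (q n)", OF lam this bdd, of 0]
  show ?thesis
    by (simp add: q0)
qed

theorem proposition2p6:
  fixes lam :: real and m :: nat and A :: "nat \<Rightarrow> circle \<Rightarrow> real"
  assumes "0 < lam" and "lam < 1" and "m \<ge> 2"
    and "\<And>c. c \<in> {..<m} \<Longrightarrow> \<exists>L. L-lipschitz_on UNIV (A c)"
  shows "closed (Lambda_set lam m A) \<and> compact (Lambda_set lam m A)"
proof -
  have contA: "continuous_on UNIV (A c)" if "c < m" for c
    using assms(4)[of c] that lipschitz_on_continuous_on by blast
  have "bounded (\<Union>c<m. range (A c))"
    using contA compact_continuous_image[OF _ compact_UNIV_circle] compact_imp_bounded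
    by (intro bounded_UN) auto
  then obtain K where K: "\<And>c x. c < m \<Longrightarrow> \<bar>A c x\<bar> \<le> K"
    unfolding bounded_real by blast
  define R where "R = K / (1 - lam)"
  define S where "S = closure (Lambda_set lam m A)"
  define B where "B = (UNIV :: circle set) \<times> {-R..R}"
  have "compact B"
    unfolding B_def using compact_UNIV_circle by (intro compact_Times) auto
  have "Lambda_set lam m A \<subseteq> B"
  proof
    fix p assume "p \<in> Lambda_set lam m A"
    then have "\<bar>snd p\<bar> \<le> R"
      unfolding R_def using Lambda_set_snd_bound[of lam m A K p] K assms(1,2) by simp
    then show "p \<in> B"
      by (auto simp: B_def mem_Times_iff)
  qed
  then have "S \<subseteq> B"
    unfolding S_def using \<open>compact B\<close> by (intro closure_minimal compact_imp_closed)
  then have "compact S"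
    using \<open>compact B\<close> by (metis S_def closed_closure compact_Int_closed inf.absorb2)
  have "closed (\<Union>c<m. skew_map lam A c ` S)"
    using contA \<open>compact S\<close>
    by (intro compact_imp_closed compact_UN compact_continuous_image continuous_on_skew_map) auto
  moreover have "Lambda_set lam m A \<subseteq> (\<Union>c<m. skew_map lam A c ` S)"
    unfolding S_def
    by (rule order_trans[OF Lambda_set_subset_images UN_mono[OF order_refl image_mono[OF closure_subset]]])
  ultimately have "S \<subseteq> (\<Union>c<m. skew_map lam A c ` S)"
    unfolding S_def by (rule closure_minimal[rotated])
  moreover have "\<bar>snd p\<bar> \<le> R" if "p \<in> S" for p
  proof -
    have "p \<in> B"
      using that \<open>S \<subseteq> B\<close> by blast
    then show ?thesis
      by (auto simp: B_def)
  qed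
  ultimately have "S \<subseteq> Lambda_set lam m A"
    by (rule subset_Lambda_setI)
  then have "Lambda_set lam m A = S"
    unfolding S_def using closure_subset by blast
  then show ?thesis
    using \<open>compact S\<close> compact_imp_closed by simp
qed

end
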